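(* Let $A\in O(m)$ be an orthogonal matrix, let $x_1,\dots,x_n$ be vectors in $\mathbb{R}^m$, and let $X=\begin{bmatrix}x_1&\dots&x_n\end{bmatrix}$ be the $m\times n$ real matrix with columns $x_1,\dots,x_n$. Then $$\sum_{i,j=1}^n\langle x_i,Ax_j\rangle^2-\sum_{i,j=1}^n\langle x_i,x_j\rangle^2\le 0,$$ and equality holds if and only if $XX^T$ commutes with $A$. In particular, when equality holds, $\operatorname{Span}\{x_1,\dots,x_n\}$ is $A$-invariant.
   Context: $\langle\cdot,\cdot\rangle$ is the standard Euclidean inner product on $\mathbb{R}^m$, and $O(m)$ is the group of real orthogonal $m\times m$ matrices. *)

theory Defs
  imports "HOL-Analysis.Analysis"
begin

end

theory Submission
  imports Defs
begin

text \<open>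
  Write \<open>S = X X\<^sup>T\<close> and give matrices the Frobenius inner product, which is the inner product
  that the type \<open>real ^ 'n ^ 'm\<close> already carries. The number \<open>\<langle>x\<^sub>i, B x\<^sub>j\<rangle>\<close> is the \<open>(i, j)\<close>
  entry of \<open>X\<^sup>T B X\<close>, so the two double sums are \<open>tr (A\<^sup>T S A S)\<close> and \<open>tr (S S)\<close>
  (\<open>sum_bilinear_squared_eq_trace\<close>). Expanding the square of the commutator and using
  that orthogonal factors preserve the Frobenius norm gives
  \<open>\<parallel>S A - A S\<parallel>\<^sup>2 = 2 tr (S S) - 2 tr (A\<^sup>T S A S)\<close> (\<open>norm_commutator_orthogonal\<close>).
  The difference of the sums is therefore \<open>-\<parallel>S A - A S\<parallel>\<^sup>2 / 2\<close>, which yields the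
  inequality and the equality case at once.

  For the invariance of the span, the kernel of \<open>S\<close> is the orthogonal complement of the span of the
  columns (\<open>gram_mult_eq_0_iff\<close>). If \<open>S\<close> commutes with \<open>A\<close>, then transposing shows that it
  commutes with \<open>A\<^sup>T\<close>; hence \<open>A\<^sup>T\<close> preserves that kernel, and \<open>A\<close> preserves its
  orthogonal complement.
\<close>

lemma inner_matrix_eq_trace:
  fixes B C :: "real ^ 'n ^ 'm"
  shows "B \<bullet> C = trace (transpose B ** C)"
proof -
  have "B \<bullet> C = (\<Sum>i\<in>UNIV. \<Sum>j\<in>UNIV. B $ i $ j * C $ i $ j)"
    by (simp add: inner_vec_def)
  also have "\<dots> = (\<Sum>j\<in>UNIV. \<Sum>i\<in>UNIV. B $ i $ j * C $ i $ j)"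
    by (rule sum.swap)
  finally show ?thesis
    by (simp add: trace_def matrix_matrix_mult_def transpose_def)
qed

lemma inner_columns_eq_entry:
  fixes B :: "real ^ 'm ^ 'm" and X :: "real ^ 'n ^ 'm"
  shows "column i X \<bullet> (B *v column j X) = (transpose X ** B ** X) $ i $ j"
proof -
  have "(transpose X ** (B ** X)) $ i $ j = (\<Sum>k\<in>UNIV. X $ k $ i * (B ** X) $ k $ j)"
    by (simp add: matrix_matrix_mult_def transpose_def)
  also have "\<dots> = column i X \<bullet> (B *v column j X)"
    by (simp add: inner_vec_def column_def matrix_matrix_mult_def matrix_vector_mult_def)
  finally show ?thesis
    by (simp add: matrix_mul_assoc)
qed

lemma sum_bilinear_squared_eq_trace:
  fixes B :: "real ^ 'm ^ 'm" and X :: "real ^ 'n ^ 'm"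
  shows "(\<Sum>i\<in>UNIV. \<Sum>j\<in>UNIV. (column i X \<bullet> (B *v column j X))\<^sup>2)
    = trace (transpose B ** (X ** transpose X) ** B ** (X ** transpose X))"
proof -
  let ?G = "transpose X ** B ** X"
  have "(\<Sum>i\<in>UNIV. \<Sum>j\<in>UNIV. (column i X \<bullet> (B *v column j X))\<^sup>2) = ?G \<bullet> ?G"
    unfolding inner_columns_eq_entry by (simp add: inner_vec_def power2_eq_square)
  also have "\<dots> = trace (transpose X ** (transpose B ** X ** transpose X ** B ** X))"
    by (simp add: inner_matrix_eq_trace matrix_transpose_mul transpose_transpose matrix_mul_assoc)
  also have "\<dots> = trace ((transpose B ** X ** transpose X ** B ** X) ** transpose X)"
    by (rule trace_mul_sym)
  finally show ?thesis
    by (simp add: matrix_mul_assoc)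
qed

text \<open>
  Since \<open>A\<close> is orthogonal, both \<open>S A\<close> and \<open>A S\<close> have the same Frobenius norm as \<open>S\<close>; the only
  other term in the expansion of the square is the cross term, which symmetry of \<open>S\<close>
  puts in the form that occurs in the theorem.
\<close>

lemma norm_commutator_orthogonal:
  fixes A S :: "real ^ 'm ^ 'm"
  assumes "orthogonal_matrix A" and "transpose S = S"
  shows "(norm (S ** A - A ** S))\<^sup>2
    = 2 * trace (S ** S) - 2 * trace (transpose A ** S ** A ** S)"
proof -
  have A: "transpose A ** A = mat 1" "A ** transpose A = mat 1"
    using assms(1) by (auto simp: orthogonal_matrix_def)
  have "(S ** A) \<bullet> (S ** A) = trace (transpose A ** (S ** S ** A))"
    by (simp add: inner_matrix_eq_trace matrix_transpose_mul assms(2) matrix_mul_assoc)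
  also have "\<dots> = trace (S ** S ** A ** transpose A)"
    by (rule trace_mul_sym)
  also have "\<dots> = trace (S ** S)"
    by (metis A(2) matrix_mul_assoc matrix_mul_rid)
  finally have SA: "(S ** A) \<bullet> (S ** A) = trace (S ** S)" .
  have "(A ** S) \<bullet> (A ** S) = trace (S ** (transpose A ** A) ** S)"
    by (simp add: inner_matrix_eq_trace matrix_transpose_mul assms(2) matrix_mul_assoc)
  then have AS: "(A ** S) \<bullet> (A ** S) = trace (S ** S)"
    by (simp add: A(1))
  have "(S ** A) \<bullet> (A ** S) = trace (transpose A ** S ** A ** S)"
    by (simp add: inner_matrix_eq_trace matrix_transpose_mul assms(2) matrix_mul_assoc)
  with SA AS show ?thesis
    by (simp add: power2_norm_eq_inner inner_diff_left inner_diff_right inner_commute)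
qed

text \<open>Pairing \<open>X X\<^sup>T u\<close> with \<open>u\<close> gives \<open>\<parallel>X\<^sup>T u\<parallel>\<^sup>2\<close>, so \<open>X X\<^sup>T\<close> and \<open>X\<^sup>T\<close> have the same kernel.\<close>

lemma gram_mult_eq_0_iff:
  fixes X :: "real ^ 'n ^ 'm"
  shows "(X ** transpose X) *v u = 0 \<longleftrightarrow> (\<forall>j. column j X \<bullet> u = 0)"
proof -
  have "u \<bullet> ((X ** transpose X) *v u) = (transpose X *v u) \<bullet> (transpose X *v u)"
    by (metis dot_lmul_matrix matrix_vector_mul_assoc vector_transpose_matrix transpose_transpose)
  then have "(X ** transpose X) *v u = 0 \<longleftrightarrow> transpose X *v u = 0"
    by (metis inner_eq_zero_iff inner_zero_right matrix_vector_mul_assoc matrix_vector_mult_0_right)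
  also have "\<dots> \<longleftrightarrow> (\<forall>j. column j X \<bullet> u = 0)"
    by (simp add: vec_eq_iff matrix_vector_mult_def transpose_def column_def inner_vec_def)
  finally show ?thesis .
qed

lemma span_columns_invariant:
  fixes A :: "real ^ 'm ^ 'm" and X :: "real ^ 'n ^ 'm"
  assumes "(X ** transpose X) ** A = A ** (X ** transpose X)"
  shows "(\<lambda>v. A *v v) ` span (range (\<lambda>j. column j X)) \<subseteq> span (range (\<lambda>j. column j X))"
proof -
  let ?S = "X ** transpose X" and ?V = "span (range (\<lambda>j. column j X))"
  have comm: "?S ** transpose A = transpose A ** ?S"
    using arg_cong[OF assms, of transpose]
    by (simp add: matrix_transpose_mul transpose_transpose)
  have "A *v column j X \<in> ?V" for j
  proof -
    \<comment> \<open>It suffices to show that the component \<open>u\<close> orthogonal to the span vanishes.\<close>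
    obtain w u where w: "w \<in> ?V" and u: "\<And>v. v \<in> ?V \<Longrightarrow> orthogonal u v"
      and wu: "A *v column j X = w + u"
      using orthogonal_subspace_decomp_exists by blast
    have "column k X \<bullet> u = 0" for k
      using u[of "column k X"] by (simp add: orthogonal_def inner_commute span_base)
    then have "?S *v u = 0"
      by (simp add: gram_mult_eq_0_iff)
    then have "?S *v (transpose A *v u) = 0"
      by (metis comm matrix_vector_mul_assoc matrix_vector_mult_0_right)
    then have "column j X \<bullet> (transpose A *v u) = 0"
      by (simp add: gram_mult_eq_0_iff)
    then have "(A *v column j X) \<bullet> u = 0"
      by (metis dot_lmul_matrix vector_transpose_matrix)
    moreover have "w \<bullet> u = 0"
      using u[OF w] by (simp add: orthogonal_def inner_commute)
    ultimately have "u = 0"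
      by (simp add: wu inner_add_left)
    with w wu show ?thesis by simp
  qed
  then have "span ((\<lambda>v. A *v v) ` range (\<lambda>j. column j X)) \<subseteq> ?V"
    by (intro span_minimal) auto
  then show ?thesis
    by (simp add: linear_span_image)
qed

theorem proposition2p2:
  fixes A :: "real ^ 'm ^ 'm"
    and x :: "'n::finite \<Rightarrow> real ^ 'm"
    and X :: "real ^ 'n ^ 'm"
  assumes "orthogonal_matrix A"
    and "\<forall>j. column j X = x j"
  shows "(\<Sum>i\<in>UNIV. \<Sum>j\<in>UNIV. (x i \<bullet> (A *v x j))\<^sup>2) - (\<Sum>i\<in>UNIV. \<Sum>j\<in>UNIV. (x i \<bullet> x j)\<^sup>2) \<le> 0
    \<and> ((\<Sum>i\<in>UNIV. \<Sum>j\<in>UNIV. (x i \<bullet> (A *v x j))\<^sup>2) - (\<Sum>i\<in>UNIV. \<Sum>j\<in>UNIV. (x i \<bullet> x j)\<^sup>2) = 0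
        \<longleftrightarrow> (X ** transpose X) ** A = A ** (X ** transpose X))
    \<and> ((\<Sum>i\<in>UNIV. \<Sum>j\<in>UNIV. (x i \<bullet> (A *v x j))\<^sup>2) - (\<Sum>i\<in>UNIV. \<Sum>j\<in>UNIV. (x i \<bullet> x j)\<^sup>2) = 0
        \<longrightarrow> (\<lambda>v. A *v v) ` span (range x) \<subseteq> span (range x))"
proof -
  let ?S = "X ** transpose X"
  define d where "d = (\<Sum>i\<in>UNIV. \<Sum>j\<in>UNIV. (x i \<bullet> (A *v x j))\<^sup>2)
    - (\<Sum>i\<in>UNIV. \<Sum>j\<in>UNIV. (x i \<bullet> x j)\<^sup>2)"
  have col: "x = (\<lambda>j. column j X)"
    using assms(2) by auto
  have "(\<Sum>i\<in>UNIV. \<Sum>j\<in>UNIV. (x i \<bullet> x j)\<^sup>2) = trace (?S ** ?S)"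
    using sum_bilinear_squared_eq_trace[of X "mat 1"] by (simp add: col transpose_mat)
  moreover have "(\<Sum>i\<in>UNIV. \<Sum>j\<in>UNIV. (x i \<bullet> (A *v x j))\<^sup>2)
      = trace (transpose A ** ?S ** A ** ?S)"
    unfolding col by (rule sum_bilinear_squared_eq_trace)
  moreover have "transpose ?S = ?S"
    by (simp add: matrix_transpose_mul transpose_transpose)
  ultimately have key: "d = - (norm (?S ** A - A ** ?S))\<^sup>2 / 2"
    unfolding d_def by (simp add: norm_commutator_orthogonal[OF assms(1)])
  have "d \<le> 0"
    by (simp add: key)
  moreover have eq: "d = 0 \<longleftrightarrow> ?S ** A = A ** ?S"
    by (simp add: key)
  moreover have "d = 0 \<longrightarrow> (\<lambda>v. A *v v) ` span (range x) \<subseteq> span (range x)"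
    using span_columns_invariant[of X A] unfolding eq col by blast
  ultimately show ?thesis
    unfolding d_def by blast
qed

end
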